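(* Let $X$ be a normed space, $C\subset X$ a non-zero normal wedge and let $T:C\to C$ be positively homogeneous, additive and Lipschitz. Let $C'\subset C$ be a bounded subset satisfying $\|T^n\|=\sup\{\|T^nx\|:x\in C'\}$ for all $n\in\mathbb{N}$. Then $$[\sup\{r_x(T):x\in C'\},\ r(T)]\subset\sigma_{ap}(T)$$ and $r(T)=\max\{t:t\in\sigma_{ap}(T)\}$.
   Context: Normed spaces are real and not assumed complete. A subset $C$ of $X$ is a cone if $sC\subset C$ for all $s\ge0$; a wedge is a convex cone (it is not assumed closed). A wedge $C$ induces a preorder: $x\le y$ iff $y-x\in C$. The wedge $C$ is normal if there is a constant $M$ such that $\|x\|\le M\|y\|$ whenever $x\le y$, $x,y\in C$. A map $T:C\to C$ is positively homogeneous if $T(sx)=sT(x)$ for all $s\ge0$, $x\in C$; additive if $T(x+y)=Tx+Ty$ for all $x,y\in C$; Lipschitz if there is $L>0$ with $\|Tx-Ty\|\le L\|x-y\|$ for all $x,y\in C$. A positively homogeneous map is bounded if $\|T\|:=\sup\{\|Tx\|/\|x\|:x\in C,\ x\ne0\}<\infty$ (positively homogeneous Lipschitz maps are bounded). The Bonsall cone spectral radius is $r(T)=\lim_{n\to\infty}\|T^n\|^{1/n}=\inf_n\|T^n\|^{1/n}$ (the limit exists), where $\|T^n\|$ is defined by the same formula as $\|T\|$. The local cone spectral radius at $x\in C$ is $r_x(T)=\limsup_{n\to\infty}\|T^nx\|^{1/n}$. The approximate point spectrum $\sigma_{ap}(T)$ is the set of all $s\ge0$ such that $\inf\{\|Tx-sx\|:x\in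 C,\ \|x\|=1\}=0$. *)

theory Defs
  imports "HOL-Analysis.Analysis"
begin

text \<open>
  A wedge is a set satisfying the library predicate \<^const>\<open>convex_cone\<close>; it need not be closed.
  Maps \<open>T : C \<rightarrow> C\<close> are total functions used only on \<open>C\<close>; every notion below depends only
  on the values of \<open>T\<close> on \<open>C\<close> provided \<open>T\<close> maps \<open>C\<close> into itself.
\<close>

definition wedge_le :: "'a::real_vector set \<Rightarrow> 'a \<Rightarrow> 'a \<Rightarrow> bool" where
  "wedge_le C x y \<longleftrightarrow> y - x \<in> C"

definition normal_wedge :: "'a::real_normed_vector set \<Rightarrow> bool" where
  "normal_wedge C \<longleftrightarrow> convex_cone C \<and>
     (\<exists>M. \<forall>x\<in>C. \<forall>y\<in>C. wedge_le C x y \<longrightarrow> norm x \<le> M * norm y)"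

definition pos_homogeneous_on :: "'a::real_vector set \<Rightarrow> ('a \<Rightarrow> 'a) \<Rightarrow> bool" where
  "pos_homogeneous_on C T \<longleftrightarrow> (\<forall>s\<ge>0. \<forall>x\<in>C. T (s *\<^sub>R x) = s *\<^sub>R T x)"

definition additive_on :: "'a::real_vector set \<Rightarrow> ('a \<Rightarrow> 'a) \<Rightarrow> bool" where
  "additive_on C T \<longleftrightarrow> (\<forall>x\<in>C. \<forall>y\<in>C. T (x + y) = T x + T y)"

text \<open>
  Suprema, infima and limits are taken in the reals. For a wedge \<open>C \<noteq> {0}\<close> and a positively
  homogeneous Lipschitz map \<open>T : C \<rightarrow> C\<close>, the sets in the next definition and in \<open>approx_point_spectrum\<close>
  are nonempty and bounded on the relevant side.
\<close>

definition cone_norm :: "'a::real_normed_vector set \<Rightarrow> ('a \<Rightarrow> 'a) \<Rightarrow> real" where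
  "cone_norm C T = Sup {norm (T x) / norm x | x. x \<in> C \<and> x \<noteq> 0}"

text \<open>The limit exists by submultiplicativity of \<open>n \<mapsto> cone_norm C (T ^^ n)\<close>.\<close>

definition cone_spectral_radius :: "'a::real_normed_vector set \<Rightarrow> ('a \<Rightarrow> 'a) \<Rightarrow> real" where
  "cone_spectral_radius C T = lim (\<lambda>n. root n (cone_norm C (T ^^ n)))"

text \<open>
  The library's \<open>limsup\<close> needs a complete lattice, hence the detour through \<^typ>\<open>ereal\<close>. If \<open>T\<close> is
  bounded on the cone, the upper limit is finite at each of its points.
\<close>

definition local_spectral_radius :: "('a::real_normed_vector \<Rightarrow> 'a) \<Rightarrow> 'a \<Rightarrow> real" where
  "local_spectral_radius T x =
     real_of_ereal (limsup (\<lambda>n. ereal (root n (norm ((T ^^ n) x)))))"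

definition approx_point_spectrum :: "'a::real_normed_vector set \<Rightarrow> ('a \<Rightarrow> 'a) \<Rightarrow> real set" where
  "approx_point_spectrum C T =
     {s. 0 \<le> s \<and> Inf {norm (T x - s *\<^sub>R x) | x. x \<in> C \<and> norm x = 1} = 0}"

end

theory Submission
  imports Defs
begin

text \<open>
  Let \<open>s\<close> lie between the supremum of the local radii on \<open>C'\<close> and the spectral radius \<open>r\<close>, and
  suppose that \<open>s\<close> is not an approximate eigenvalue. By homogeneity, \<open>norm (T u - s u) \<ge> \<delta> norm u\<close>
  on \<open>C\<close> for some \<open>\<delta> > 0\<close>, and such a bound with \<open>\<delta> / 2\<close> persists for all \<open>t > s\<close> near \<open>s\<close>. For
  these \<open>t\<close> and for \<open>x \<in> C'\<close>, the partial sums of the Neumann series of \<open>(t - T)\<^sup>-\<^sup>1 x\<close> and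
  \<open>(t - T)\<^sup>-\<^sup>2 x\<close> lie in \<open>C\<close>, and they satisfy the resolvent equations up to errors that vanish in the
  limit, because \<open>t\<close> exceeds the local radius of \<open>x\<close>. Working with partial sums avoids
  the limits of the series, which need not exist in \<open>C\<close>. Applying the lower bound twice shows that the partial sums
  of \<open>\<Sum>n. (n + 1) t ^ (- n - 2) T ^ n x\<close> have norm at most about \<open>4 norm x / \<delta>\<^sup>2\<close>.

  The terms of this series lie in \<open>C\<close>, so normality transfers the bound from the partial sums to each
  term. Letting \<open>t\<close> decrease to \<open>s\<close> gives \<open>(n + 1) norm (T ^ n x) \<le> K s ^ (n + 2)\<close> with \<open>K\<close>
  independent of \<open>n\<close> and of \<open>x \<in> C'\<close> (lemma \<open>iterate_bound_of_spectral_gap\<close>). The supremum over \<open>C'\<close>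
  is \<open>(n + 1)\<close> times the norm of \<open>T ^ n\<close>, which is at least \<open>(n + 1) r ^ n \<ge> (n + 1) s ^ n\<close>. For
  \<open>s > 0\<close> this is impossible for large \<open>n\<close> (lemma \<open>mem_approx_point_spectrum\<close>).

  The unit sphere of \<open>C\<close> also computes all the norms, and its local radii are at most \<open>r\<close>. The same
  argument with the unit sphere in place of \<open>C'\<close> therefore shows that \<open>r\<close> is an approximate
  eigenvalue. No approximate eigenvalue \<open>t\<close> exceeds \<open>r\<close>: by the Lipschitz condition,
  \<open>T u \<approx> t u\<close> implies \<open>T ^ n u \<approx> t ^ n u\<close>, so \<open>t ^ n\<close> is at most the norm of \<open>T ^ n\<close>.
\<close>

section \<open>Submultiplicative sequences\<close>

text \<open>
  The multiplicative form of Fekete's lemma. Writing \<open>n = k m + j\<close> with \<open>j < m\<close> compares \<open>a n\<close> with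
  \<open>q ^ n\<close> up to a constant for every \<open>q\<close> above one of the numbers \<open>root m (a m)\<close>, and the
  \<open>n\<close>-th root removes the constant.
\<close>
lemma submultiplicative_root_tendsto_Inf:
  fixes a :: "nat \<Rightarrow> real"
  assumes nonneg: "\<And>n. 0 \<le> a n" and submult: "\<And>m n. a (m + n) \<le> a m * a n"
  shows "(\<lambda>n. root n (a n)) \<longlonglongrightarrow> Inf ((\<lambda>n. root n (a n)) ` {1..})"
proof -
  define r where "r = Inf ((\<lambda>n. root n (a n)) ` {1..})"
  have bdd: "bdd_below ((\<lambda>n. root n (a n)) ` {1..})"
    by (rule bdd_belowI[of _ 0]) (auto simp: nonneg)
  have lower: "r \<le> root n (a n)" if "1 \<le> n" for n
    unfolding r_def using bdd that by (intro cInf_lower) auto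
  have r_nonneg: "0 \<le> r"
    unfolding r_def by (rule cInf_greatest) (auto simp: nonneg)
  have pow: "a (k * m + j) \<le> a m ^ k * a j" for k m j
  proof (induction k)
    case (Suc k)
    have "a (Suc k * m + j) \<le> a m * a (k * m + j)"
      using submult[of m "k * m + j"] by (simp add: algebra_simps)
    also have "\<dots> \<le> a m * (a m ^ k * a j)"
      using Suc nonneg by (intro mult_left_mono) auto
    finally show ?case by simp
  qed simp
  have "\<forall>\<^sub>F n in sequentially. root n (a n) < u" if u: "r < u" for u
  proof -
    obtain q where q: "r < q" "q < u" using dense[OF u] by blast
    have "0 < q" using q r_nonneg by simp
    have "\<exists>x\<in>(\<lambda>n. root n (a n)) ` {1..}. x < q"
      using q(1) unfolding r_def by (intro cInf_lessD) auto
    then obtain m where m: "1 \<le> m" "root m (a m) < q" by auto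
    have am: "a m \<le> q ^ m"
    proof -
      have "a m = root m (a m) ^ m" using m nonneg by simp
      also have "\<dots> \<le> q ^ m" using m nonneg by (intro power_mono) auto
      finally show ?thesis .
    qed
    define K where "K = (\<Sum>j<m. a j / q ^ j) + 1"
    have Kpos: "0 < K"
      unfolding K_def using nonneg \<open>0 < q\<close> by (intro add_nonneg_pos sum_nonneg) auto
    have bound: "a n \<le> K * q ^ n" for n
    proof -
      let ?k = "n div m" and ?j = "n mod m"
      have "a ?j / q ^ ?j \<le> (\<Sum>j<m. a j / q ^ j)"
        using m nonneg \<open>0 < q\<close> by (intro member_le_sum) auto
      then have aj: "a ?j \<le> K * q ^ ?j"
        unfolding K_def using \<open>0 < q\<close>
        by (simp add: pos_divide_le_eq[symmetric])
      have "a n = a (?k * m + ?j)" by simp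
      also have "\<dots> \<le> a m ^ ?k * a ?j" by (rule pow)
      also have "\<dots> \<le> (q ^ m) ^ ?k * (K * q ^ ?j)"
        using am aj nonneg \<open>0 < q\<close> by (intro mult_mono power_mono) auto
      also have "\<dots> = K * q ^ (m * ?k + ?j)" by (simp only: power_add power_mult) simp
      also have "\<dots> = K * q ^ n" by simp
      finally show ?thesis .
    qed
    have "(\<lambda>n. root n K * q) \<longlonglongrightarrow> 1 * q"
      by (intro tendsto_intros LIMSEQ_root_const Kpos)
    then have "\<forall>\<^sub>F n in sequentially. root n K * q < u"
      using q(2) by (simp add: order_tendstoD)
    moreover have "\<forall>\<^sub>F n in sequentially. root n (a n) \<le> root n K * q"
      using eventually_ge_at_top[of 1]
    proof eventually_elim
      case (elim n)
      have "root n (a n) \<le> root n (K * q ^ n)"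
        using elim bound by simp
      also have "\<dots> = root n K * q"
        using elim \<open>0 < q\<close> by (simp add: real_root_mult real_root_power_cancel)
      finally show ?case .
    qed
    ultimately show ?thesis by eventually_elim simp
  qed
  moreover have "\<forall>\<^sub>F n in sequentially. l < root n (a n)" if "l < r" for l
    using eventually_ge_at_top[of 1]
    by eventually_elim (use lower that in force)
  ultimately show ?thesis
    unfolding r_def[symmetric] by (intro order_tendstoI)
qed

section \<open>Additive Lipschitz maps of a wedge\<close>

locale lipschitz_wedge_map =
  fixes C :: "'a::real_normed_vector set" and T :: "'a \<Rightarrow> 'a" and L :: real
  assumes cone: "convex_cone C" and nonzero: "C \<noteq> {0}" and maps: "T ` C \<subseteq> C"
    and homogeneous: "pos_homogeneous_on C T" and additive: "additive_on C T"
    and lipschitz: "L-lipschitz_on C T"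
begin

lemma zero_in: "0 \<in> C"
  using cone by (rule convex_cone_contains_0)

lemma add_in: "x \<in> C \<Longrightarrow> y \<in> C \<Longrightarrow> x + y \<in> C"
  using cone by (rule convex_cone_add)

lemma scaleR_in: "0 \<le> c \<Longrightarrow> x \<in> C \<Longrightarrow> c *\<^sub>R x \<in> C"
  using cone by (rule convex_cone_scaleR)

lemma sum_in: "(\<And>i. i \<in> I \<Longrightarrow> f i \<in> C) \<Longrightarrow> sum f I \<in> C"
  by (induction I rule: infinite_finite_induct) (auto intro: add_in zero_in)

lemma T_scaleR: "0 \<le> c \<Longrightarrow> x \<in> C \<Longrightarrow> T (c *\<^sub>R x) = c *\<^sub>R T x"
  using homogeneous unfolding pos_homogeneous_on_def by blast

lemma T_add: "x \<in> C \<Longrightarrow> y \<in> C \<Longrightarrow> T (x + y) = T x + T y"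
  using additive unfolding additive_on_def by blast

lemma T_zero: "T 0 = 0"
  using T_scaleR[of 0 0] zero_in by simp

lemma iterate_in: "x \<in> C \<Longrightarrow> (T ^^ n) x \<in> C"
  by (induction n) (use maps in auto)

lemma iterate_scaleR: "0 \<le> c \<Longrightarrow> x \<in> C \<Longrightarrow> (T ^^ n) (c *\<^sub>R x) = c *\<^sub>R (T ^^ n) x"
  by (induction n) (auto simp: T_scaleR iterate_in)

lemma lipschitz_nonneg: "0 \<le> L"
  using lipschitz by (rule lipschitz_on_nonneg)

lemma norm_T_le: "x \<in> C \<Longrightarrow> norm (T x) \<le> L * norm x"
  using lipschitz_on_normD[OF lipschitz, of x 0] by (simp add: zero_in T_zero)

lemma norm_iterate_le: "x \<in> C \<Longrightarrow> norm ((T ^^ n) x) \<le> L ^ n * norm x"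
proof (induction n)
  case (Suc n)
  have "norm ((T ^^ Suc n) x) \<le> L * norm ((T ^^ n) x)"
    using norm_T_le[OF iterate_in] Suc.prems by simp
  also have "\<dots> \<le> L * (L ^ n * norm x)"
    using Suc lipschitz_nonneg by (intro mult_left_mono) auto
  finally show ?case by simp
qed simp

lemma unit_vector: "\<exists>x\<in>C. norm x = 1"
proof -
  obtain x where "x \<in> C" "x \<noteq> 0"
    using nonzero zero_in by blast
  then have "(1 / norm x) *\<^sub>R x \<in> C" "norm ((1 / norm x) *\<^sub>R x) = 1"
    by (auto intro: scaleR_in)
  then show ?thesis by blast
qed

section \<open>Norms of the iterates and the spectral radius\<close>

lemma norm_iterate_le_cone_norm:
  assumes "x \<in> C"
  shows "norm ((T ^^ n) x) \<le> cone_norm C (T ^^ n) * norm x"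
proof (cases "x = 0")
  case True
  have "(T ^^ n) 0 = 0" using iterate_scaleR[of 0 0 n] zero_in by simp
  then show ?thesis using True by simp
next
  case False
  have "norm ((T ^^ n) x) / norm x \<le> cone_norm C (T ^^ n)"
    unfolding cone_norm_def
  proof (rule cSup_upper)
    show "bdd_above {norm ((T ^^ n) x) / norm x |x. x \<in> C \<and> x \<noteq> 0}"
      by (rule bdd_aboveI[of _ "L ^ n"]) (auto simp: pos_divide_le_eq norm_iterate_le)
  qed (use assms False in auto)
  then show ?thesis using False by (simp add: divide_simps)
qed

lemma cone_norm_iterate_le:
  assumes "\<And>x. x \<in> C \<Longrightarrow> norm ((T ^^ n) x) \<le> b * norm x"
  shows "cone_norm C (T ^^ n) \<le> b"
  unfolding cone_norm_def
proof (rule cSup_least)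
  show "{norm ((T ^^ n) x) / norm x |x. x \<in> C \<and> x \<noteq> 0} \<noteq> {}"
    using unit_vector by force
qed (auto simp: pos_divide_le_eq assms)

lemma cone_norm_iterate_nonneg: "0 \<le> cone_norm C (T ^^ n)"
proof -
  obtain x where "x \<in> C" "norm x = 1" using unit_vector by blast
  then show ?thesis
    using norm_iterate_le_cone_norm[of x n] order_trans[OF norm_ge_zero] by fastforce
qed

lemma cone_norm_iterate_submult:
  "cone_norm C (T ^^ (m + n)) \<le> cone_norm C (T ^^ m) * cone_norm C (T ^^ n)"
proof (rule cone_norm_iterate_le)
  fix x assume x: "x \<in> C"
  have "norm ((T ^^ (m + n)) x) = norm ((T ^^ m) ((T ^^ n) x))" by (simp add: funpow_add)
  also have "\<dots> \<le> cone_norm C (T ^^ m) * norm ((T ^^ n) x)"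
    using x by (intro norm_iterate_le_cone_norm iterate_in)
  also have "\<dots> \<le> cone_norm C (T ^^ m) * (cone_norm C (T ^^ n) * norm x)"
    using x by (intro mult_left_mono norm_iterate_le_cone_norm cone_norm_iterate_nonneg)
  finally show "norm ((T ^^ (m + n)) x) \<le> cone_norm C (T ^^ m) * cone_norm C (T ^^ n) * norm x"
    by (simp add: mult.assoc)
qed

lemma root_cone_norm_tendsto:
  "(\<lambda>n. root n (cone_norm C (T ^^ n))) \<longlonglongrightarrow> cone_spectral_radius C T"
proof -
  have "convergent (\<lambda>n. root n (cone_norm C (T ^^ n)))"
    using submultiplicative_root_tendsto_Inf[of "\<lambda>n. cone_norm C (T ^^ n)",
        OF cone_norm_iterate_nonneg cone_norm_iterate_submult]
    by (rule convergentI)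
  then show ?thesis
    unfolding cone_spectral_radius_def convergent_LIMSEQ_iff .
qed

lemma cone_spectral_radius_le_root:
  assumes "1 \<le> n"
  shows "cone_spectral_radius C T \<le> root n (cone_norm C (T ^^ n))"
proof -
  let ?a = "\<lambda>n. root n (cone_norm C (T ^^ n))"
  have "cone_spectral_radius C T = Inf (?a ` {1..})"
    using root_cone_norm_tendsto
      submultiplicative_root_tendsto_Inf[of "\<lambda>n. cone_norm C (T ^^ n)",
        OF cone_norm_iterate_nonneg cone_norm_iterate_submult]
    by (rule LIMSEQ_unique)
  also have "\<dots> \<le> ?a n"
    using assms
    by (intro cInf_lower bdd_belowI[of _ 0]) (auto simp: cone_norm_iterate_nonneg)
  finally show ?thesis .
qed

lemma cone_spectral_radius_nonneg: "0 \<le> cone_spectral_radius C T"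
  using root_cone_norm_tendsto
  by (rule LIMSEQ_le_const) (intro exI allI impI real_root_ge_zero cone_norm_iterate_nonneg)

lemma cone_spectral_radius_power_le:
  assumes "1 \<le> n"
  shows "cone_spectral_radius C T ^ n \<le> cone_norm C (T ^^ n)"
proof -
  have "cone_spectral_radius C T ^ n \<le> root n (cone_norm C (T ^^ n)) ^ n"
    using cone_spectral_radius_le_root[OF assms] cone_spectral_radius_nonneg
    by (intro power_mono)
  then show ?thesis using assms cone_norm_iterate_nonneg by simp
qed

lemma limsup_root_le_cone_spectral_radius:
  assumes "x \<in> C"
  shows "limsup (\<lambda>n. ereal (root n (norm ((T ^^ n) x)))) \<le> ereal (cone_spectral_radius C T)"
proof -
  \<comment> \<open>The summand \<open>1\<close> keeps the constant positive, so that its roots tend to \<open>1\<close> even for \<open>x = 0\<close>.\<close>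
  let ?b = "\<lambda>n. root n (cone_norm C (T ^^ n)) * root n (norm x + 1)"
  have "?b \<longlonglongrightarrow> cone_spectral_radius C T * 1"
    by (intro tendsto_mult root_cone_norm_tendsto LIMSEQ_root_const) (simp add: add_nonneg_pos)
  then have lim: "limsup (\<lambda>n. ereal (?b n)) = ereal (cone_spectral_radius C T)"
    by (intro lim_imp_Limsup tendsto_ereal) simp_all
  have "\<forall>\<^sub>F n in sequentially. ereal (root n (norm ((T ^^ n) x))) \<le> ereal (?b n)"
    using eventually_ge_at_top[of 1]
  proof eventually_elim
    case (elim n)
    have "norm ((T ^^ n) x) \<le> cone_norm C (T ^^ n) * (norm x + 1)"
      using norm_iterate_le_cone_norm[OF assms, of n] cone_norm_iterate_nonneg[of n]
      by (simp add: distrib_left)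
    then have "root n (norm ((T ^^ n) x)) \<le> root n (cone_norm C (T ^^ n) * (norm x + 1))"
      using elim by (simp only: real_root_le_iff)
    then show ?case by (simp add: real_root_mult)
  qed
  then have "limsup (\<lambda>n. ereal (root n (norm ((T ^^ n) x)))) \<le> limsup (\<lambda>n. ereal (?b n))"
    by (rule Limsup_mono)
  then show ?thesis unfolding lim .
qed

lemma limsup_root_nonneg: "0 \<le> limsup (\<lambda>n. ereal (root n (norm ((T ^^ n) x))))"
  by (rule le_Limsup) (auto intro!: always_eventually real_root_ge_zero)

lemma limsup_root_eq_local_spectral_radius:
  assumes "x \<in> C"
  shows "limsup (\<lambda>n. ereal (root n (norm ((T ^^ n) x)))) = ereal (local_spectral_radius T x)"
proof -
  let ?l = "limsup (\<lambda>n. ereal (root n (norm ((T ^^ n) x))))"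
  have "?l \<le> ereal (cone_spectral_radius C T)"
    using assms by (rule limsup_root_le_cone_spectral_radius)
  then show ?thesis
    using limsup_root_nonneg[of x] unfolding local_spectral_radius_def by (cases ?l) auto
qed

lemma local_spectral_radius_le:
  "x \<in> C \<Longrightarrow> local_spectral_radius T x \<le> cone_spectral_radius C T"
  using limsup_root_le_cone_spectral_radius limsup_root_eq_local_spectral_radius by fastforce

lemma local_spectral_radius_nonneg: "x \<in> C \<Longrightarrow> 0 \<le> local_spectral_radius T x"
  using limsup_root_nonneg[of x] limsup_root_eq_local_spectral_radius[of x] by simp

lemma eventually_norm_iterate_le:
  assumes "x \<in> C" "local_spectral_radius T x < q"
  shows "\<forall>\<^sub>F n in sequentially. norm ((T ^^ n) x) \<le> q ^ n"
proof -
  have "\<forall>\<^sub>F n in sequentially. ereal (root n (norm ((T ^^ n) x))) < ereal q"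
    using assms by (intro Limsup_lessD) (simp add: limsup_root_eq_local_spectral_radius)
  then show ?thesis
    using eventually_ge_at_top[of 1]
  proof eventually_elim
    case (elim n)
    have "norm ((T ^^ n) x) = root n (norm ((T ^^ n) x)) ^ n" using elim by simp
    also have "\<dots> \<le> q ^ n" using elim by (intro power_mono) auto
    finally show ?case .
  qed
qed

section \<open>Approximate eigenvalues\<close>

text \<open>By homogeneity, a gap in the spectrum is a lower bound for \<open>T - s\<close> on the whole wedge.\<close>
lemma not_approx_point_spectrumD:
  assumes "0 \<le> s" "s \<notin> approx_point_spectrum C T"
  obtains \<delta> where "0 < \<delta>" "\<And>u. u \<in> C \<Longrightarrow> \<delta> * norm u \<le> norm (T u - s *\<^sub>R u)"
proof
  let ?S = "{norm (T x - s *\<^sub>R x) |x. x \<in> C \<and> norm x = 1}"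
  have "?S \<noteq> {}" using unit_vector by blast
  then have "0 \<le> Inf ?S" by (rule cInf_greatest) auto
  then show "0 < Inf ?S"
    using assms unfolding approx_point_spectrum_def by auto
  fix u assume u: "u \<in> C"
  show "Inf ?S * norm u \<le> norm (T u - s *\<^sub>R u)"
  proof (cases "u = 0")
    case False
    define v where "v = (1 / norm u) *\<^sub>R u"
    have v: "v \<in> C" "norm v = 1" "u = norm u *\<^sub>R v"
      using False u by (auto simp: v_def intro: scaleR_in)
    have "Inf ?S \<le> norm (T v - s *\<^sub>R v)"
      by (rule cInf_lower) (use v in \<open>auto intro!: bdd_belowI[of _ 0]\<close>)
    moreover have "T u - s *\<^sub>R u = norm u *\<^sub>R (T v - s *\<^sub>R v)"
      using T_scaleR[of "norm u" v] v by (metis norm_ge_zero scaleR_left_commute scaleR_right_diff_distrib)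
    then have "norm (T u - s *\<^sub>R u) = norm u * norm (T v - s *\<^sub>R v)" by simp
    ultimately show ?thesis
      by (simp add: mult.commute mult_left_mono)
  qed simp
qed

lemma iterate_approx_eigenvector:
  assumes "0 \<le> t"
  shows "\<exists>K\<ge>0. \<forall>x\<in>C. norm ((T ^^ n) x - t ^ n *\<^sub>R x) \<le> K * norm (T x - t *\<^sub>R x)"
proof (induction n)
  case 0
  show ?case by (intro exI[of _ 0]) simp
next
  case (Suc n)
  then obtain K where K: "0 \<le> K"
    "\<And>x. x \<in> C \<Longrightarrow> norm ((T ^^ n) x - t ^ n *\<^sub>R x) \<le> K * norm (T x - t *\<^sub>R x)" by blast
  show ?case
  proof (intro exI[of _ "L * K + t ^ n"] conjI ballI)
    show "0 \<le> L * K + t ^ n" using K assms lipschitz_nonneg by simp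
    fix x assume x: "x \<in> C"
    have "(T ^^ Suc n) x - t ^ Suc n *\<^sub>R x
        = (T ((T ^^ n) x) - T (t ^ n *\<^sub>R x)) + t ^ n *\<^sub>R (T x - t *\<^sub>R x)"
      using assms x by (simp add: T_scaleR algebra_simps)
    then have "norm ((T ^^ Suc n) x - t ^ Suc n *\<^sub>R x)
        \<le> norm (T ((T ^^ n) x) - T (t ^ n *\<^sub>R x)) + norm (t ^ n *\<^sub>R (T x - t *\<^sub>R x))"
      by (metis norm_triangle_ineq)
    also have "\<dots> \<le> L * norm ((T ^^ n) x - t ^ n *\<^sub>R x) + t ^ n * norm (T x - t *\<^sub>R x)"
      using lipschitz_on_normD[OF lipschitz, of "(T ^^ n) x" "t ^ n *\<^sub>R x"] x assms
      by (simp add: iterate_in scaleR_in)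
    also have "\<dots> \<le> L * (K * norm (T x - t *\<^sub>R x)) + t ^ n * norm (T x - t *\<^sub>R x)"
      using K(2)[OF x] lipschitz_nonneg by (intro add_right_mono mult_left_mono)
    finally show "norm ((T ^^ Suc n) x - t ^ Suc n *\<^sub>R x) \<le> (L * K + t ^ n) * norm (T x - t *\<^sub>R x)"
      by (simp add: algebra_simps)
  qed
qed

text \<open>An approximate eigenvector of \<open>T\<close> for \<open>t\<close> is one of \<open>T ^^ n\<close> for \<open>t ^ n\<close>.\<close>
lemma approx_point_spectrum_power_le:
  assumes "t \<in> approx_point_spectrum C T"
  shows "t ^ n \<le> cone_norm C (T ^^ n)"
proof (rule field_le_epsilon)
  fix e :: real assume "0 < e"
  let ?S = "{norm (T x - t *\<^sub>R x) |x. x \<in> C \<and> norm x = 1}"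
  have t: "0 \<le> t" "Inf ?S = 0" using assms unfolding approx_point_spectrum_def by auto
  obtain K where K: "0 \<le> K"
    "\<And>x. x \<in> C \<Longrightarrow> norm ((T ^^ n) x - t ^ n *\<^sub>R x) \<le> K * norm (T x - t *\<^sub>R x)"
    using iterate_approx_eigenvector[OF t(1)] by blast
  have "?S \<noteq> {}" using unit_vector by blast
  moreover have "Inf ?S < e / (K + 1)" using t(2) \<open>0 < e\<close> K(1) by simp
  ultimately obtain x where x: "x \<in> C" "norm x = 1" "norm (T x - t *\<^sub>R x) < e / (K + 1)"
    using cInf_lessD[of ?S] by auto
  have "t ^ n = norm (t ^ n *\<^sub>R x)" using x t by simp
  also have "\<dots> \<le> norm ((T ^^ n) x) + norm ((T ^^ n) x - t ^ n *\<^sub>R x)"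
    by (metis norm_minus_commute norm_triangle_sub)
  also have "\<dots> \<le> cone_norm C (T ^^ n) + K * norm (T x - t *\<^sub>R x)"
    using norm_iterate_le_cone_norm[OF x(1), of n] K(2)[OF x(1)] x(2) by simp
  also have "K * norm (T x - t *\<^sub>R x) \<le> (K + 1) * (e / (K + 1))"
    using x(3) K(1) by (intro mult_mono) auto
  also have "\<dots> = e" using K(1) by simp
  finally show "t ^ n \<le> cone_norm C (T ^^ n) + e" by simp
qed

lemma approx_point_spectrum_le:
  assumes "t \<in> approx_point_spectrum C T"
  shows "t \<le> cone_spectral_radius C T"
proof -
  have "0 \<le> t" using assms unfolding approx_point_spectrum_def by simp
  have "t \<le> root n (cone_norm C (T ^^ n))" if "1 \<le> n" for n
  proof -
    have "t = root n (t ^ n)" using that \<open>0 \<le> t\<close> by (simp add: real_root_power_cancel)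
    also have "\<dots> \<le> root n (cone_norm C (T ^^ n))"
      using that approx_point_spectrum_power_le[OF assms] by simp
    finally show ?thesis .
  qed
  then show ?thesis
    using root_cone_norm_tendsto by (intro LIMSEQ_le_const) auto
qed

section \<open>Truncated resolvent series\<close>

lemma truncated_resolvent:
  assumes "0 \<le> c" "x \<in> C"
  defines "y \<equiv> \<lambda>N. \<Sum>k<N. c ^ k *\<^sub>R (T ^^ k) x"
  shows "y N - c *\<^sub>R T (y N) = x - c ^ N *\<^sub>R (T ^^ N) x"
proof (induction N)
  case 0
  show ?case by (simp add: y_def T_zero)
next
  case (Suc N)
  have "y N \<in> C" unfolding y_def using assms(1,2) by (intro sum_in scaleR_in iterate_in) auto
  moreover have "y (Suc N) = y N + c ^ N *\<^sub>R (T ^^ N) x" by (simp add: y_def)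
  ultimately have "T (y (Suc N)) = T (y N) + c ^ N *\<^sub>R (T ^^ Suc N) x"
    using assms(1,2) by (simp add: T_add T_scaleR scaleR_in iterate_in)
  with Suc \<open>y (Suc N) = _\<close> show ?case by (simp add: algebra_simps)
qed

lemma truncated_resolvent_square:
  assumes "0 \<le> c" "x \<in> C"
  defines "w \<equiv> \<lambda>N. \<Sum>k<N. (real (k + 1) * c ^ k) *\<^sub>R (T ^^ k) x"
  shows "w N - c *\<^sub>R T (w N) = (\<Sum>k<N. c ^ k *\<^sub>R (T ^^ k) x) - (real N * c ^ N) *\<^sub>R (T ^^ N) x"
proof (induction N)
  case 0
  show ?case by (simp add: w_def T_zero)
next
  case (Suc N)
  have "w N \<in> C" unfolding w_def using assms(1,2) by (intro sum_in scaleR_in iterate_in) auto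
  moreover have *: "w (Suc N) = w N + (real (N + 1) * c ^ N) *\<^sub>R (T ^^ N) x" by (simp add: w_def)
  ultimately have "T (w (Suc N)) = T (w N) + (real (N + 1) * c ^ N) *\<^sub>R (T ^^ Suc N) x"
    using assms(1,2) by (simp add: T_add T_scaleR scaleR_in iterate_in)
  with Suc * show ?case by (simp add: algebra_simps)
qed

text \<open>
  The partial sums of \<open>\<Sum>k. (k + 1) c\<^sup>k T\<^sup>k x\<close> approximate \<open>(1 - c T)\<^sup>-\<^sup>2 x\<close>, so that applying the lower
  bound for \<open>1 - c T\<close> twice bounds them by \<open>norm x / \<epsilon>\<^sup>2\<close>. All summands lie in the wedge, hence each
  is dominated by the partial sum and normality bounds it too. Had the first power of the
  resolvent been used, the factor \<open>n + 1\<close> would be missing, and it is this factor that later rules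
  out a spectral gap at the spectral radius.
\<close>
lemma resolvent_square_coefficient_bound:
  assumes "0 \<le> M" and normal: "\<And>u v. u \<in> C \<Longrightarrow> v \<in> C \<Longrightarrow> wedge_le C u v \<Longrightarrow> norm u \<le> M * norm v"
    and c: "0 \<le> c" and x: "x \<in> C" and \<epsilon>: "0 < \<epsilon>"
    and gap: "\<And>u. u \<in> C \<Longrightarrow> \<epsilon> * norm u \<le> norm (u - c *\<^sub>R T u)"
    and tail: "(\<lambda>N. real N * (c ^ N * norm ((T ^^ N) x))) \<longlonglongrightarrow> 0"
  shows "\<epsilon>\<^sup>2 * (real (n + 1) * (c ^ n * norm ((T ^^ n) x))) \<le> M * norm x"
proof -
  define b where "b N = real N * (c ^ N * norm ((T ^^ N) x))" for N
  let ?lhs = "\<epsilon>\<^sup>2 * (real (n + 1) * (c ^ n * norm ((T ^^ n) x)))"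
  have "?lhs \<le> M * (norm x + (1 + \<epsilon>) * b N)" if N: "n < N" for N
  proof -
    define y where "y = (\<Sum>k<N. c ^ k *\<^sub>R (T ^^ k) x)"
    define f where "f k = (real (k + 1) * c ^ k) *\<^sub>R (T ^^ k) x" for k
    define w where "w = (\<Sum>k<N. f k)"
    have f: "f k \<in> C" for k unfolding f_def using c x by (intro scaleR_in iterate_in) auto
    have y: "y \<in> C" unfolding y_def using c x by (intro sum_in scaleR_in iterate_in) auto
    have w: "w \<in> C" unfolding w_def by (intro sum_in f)
    have "w - f n = (\<Sum>k\<in>{..<N} - {n}. f k)"
      unfolding w_def using N by (subst sum_diff1) auto
    then have "wedge_le C (f n) w"
      unfolding wedge_le_def by (simp add: sum_in f)
    then have "norm (f n) \<le> M * norm w" by (intro normal f w)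
    have "\<epsilon> * norm y \<le> norm (x - c ^ N *\<^sub>R (T ^^ N) x)"
      using gap[OF y] truncated_resolvent[OF c x, of N] by (simp add: y_def)
    also have "\<dots> \<le> norm x + c ^ N * norm ((T ^^ N) x)"
      using norm_triangle_ineq4[of x "c ^ N *\<^sub>R (T ^^ N) x"] c by simp
    also have "\<dots> \<le> norm x + b N"
    proof -
      have "1 * (c ^ N * norm ((T ^^ N) x)) \<le> real N * (c ^ N * norm ((T ^^ N) x))"
        using N c by (intro mult_right_mono) auto
      then show ?thesis by (simp add: b_def)
    qed
    finally have y_le: "\<epsilon> * norm y \<le> norm x + b N" .
    have "\<epsilon> * norm w \<le> norm (y - (real N * c ^ N) *\<^sub>R (T ^^ N) x)"
      using gap[OF w] truncated_resolvent_square[OF c x, of N] by (simp add: w_def f_def y_def)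
    also have "\<dots> \<le> norm y + b N"
      using norm_triangle_ineq4[of y "(real N * c ^ N) *\<^sub>R (T ^^ N) x"] c
      by (simp add: b_def mult.assoc abs_mult)
    finally have "\<epsilon> * (\<epsilon> * norm w) \<le> \<epsilon> * (norm y + b N)"
      using \<epsilon> by (intro mult_left_mono) auto
    also have "\<dots> \<le> norm x + (1 + \<epsilon>) * b N"
      using y_le by (simp add: algebra_simps)
    finally have w_le: "\<epsilon>\<^sup>2 * norm w \<le> norm x + (1 + \<epsilon>) * b N"
      by (simp add: power2_eq_square mult.assoc)
    have "?lhs = \<epsilon>\<^sup>2 * norm (f n)"
      using c by (simp add: f_def abs_mult mult.assoc)
    also have "\<dots> \<le> \<epsilon>\<^sup>2 * (M * norm w)"
      using \<open>norm (f n) \<le> M * norm w\<close> by (intro mult_left_mono) auto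
    also have "\<dots> = M * (\<epsilon>\<^sup>2 * norm w)" by simp
    also have "\<dots> \<le> M * (norm x + (1 + \<epsilon>) * b N)"
      using w_le \<open>0 \<le> M\<close> by (rule mult_left_mono)
    finally show ?thesis .
  qed
  moreover have "(\<lambda>N. M * (norm x + (1 + \<epsilon>) * b N)) \<longlonglongrightarrow> M * (norm x + (1 + \<epsilon>) * 0)"
    unfolding b_def by (intro tendsto_intros tail)
  ultimately have "?lhs \<le> M * (norm x + (1 + \<epsilon>) * 0)"
    by (intro LIMSEQ_le_const) (auto intro!: exI[of _ "Suc n"])
  then show ?thesis by simp
qed

text \<open>
  The resolvent exists at \<open>t > s\<close>, and the gap \<open>\<delta>\<close> at \<open>s\<close> leaves a gap \<open>\<delta> / 2\<close> at every \<open>t\<close> close to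
  \<open>s\<close>. The resulting bounds do not degenerate as \<open>t\<close> decreases to \<open>s\<close>. They are stated without
  division by \<open>s\<close>, which may be \<open>0\<close>.
\<close>
lemma iterate_bound_of_spectral_gap:
  assumes "0 \<le> M" and normal: "\<And>u v. u \<in> C \<Longrightarrow> v \<in> C \<Longrightarrow> wedge_le C u v \<Longrightarrow> norm u \<le> M * norm v"
    and x: "x \<in> C" and s: "local_spectral_radius T x \<le> s" and \<delta>: "0 < \<delta>"
    and gap: "\<And>u. u \<in> C \<Longrightarrow> \<delta> * norm u \<le> norm (T u - s *\<^sub>R u)"
  shows "(\<delta> / 2)\<^sup>2 * (real (n + 1) * norm ((T ^^ n) x)) \<le> M * norm x * s ^ (n + 2)"
proof -
  let ?lhs = "(\<delta> / 2)\<^sup>2 * (real (n + 1) * norm ((T ^^ n) x))"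
  have "0 \<le> s" using local_spectral_radius_nonneg[OF x] s by simp
  have *: "?lhs \<le> M * norm x * t ^ (n + 2)" if t: "s < t" "t < s + \<delta> / 2" for t
  proof -
    have "0 < t" using t \<open>0 \<le> s\<close> by simp
    obtain q where q: "s < q" "q < t" using dense[OF t(1)] by blast
    have "norm (q / t) < 1" using q \<open>0 \<le> s\<close> by simp
    then have geometric: "(\<lambda>N. real N * (q / t) ^ N) \<longlonglongrightarrow> 0"
      using powser_times_n_limit_0[of "q / t"] by simp
    have "\<forall>\<^sub>F N in sequentially. norm ((T ^^ N) x) \<le> q ^ N"
      using x s q by (intro eventually_norm_iterate_le) auto
    then have "\<forall>\<^sub>F N in sequentially.
        norm (real N * ((1 / t) ^ N * norm ((T ^^ N) x))) \<le> real N * (q / t) ^ N"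
    proof eventually_elim
      case (elim N)
      then have "(1 / t) ^ N * norm ((T ^^ N) x) \<le> (1 / t) ^ N * q ^ N"
        using \<open>0 < t\<close> by (intro mult_left_mono) auto
      also have "\<dots> = (q / t) ^ N" by (simp flip: power_mult_distrib)
      finally show ?case using \<open>0 < t\<close> by (simp add: abs_mult mult_left_mono)
    qed
    from Lim_null_comparison[OF this geometric]
    have tail: "(\<lambda>N. real N * ((1 / t) ^ N * norm ((T ^^ N) x))) \<longlonglongrightarrow> 0" .
    have "\<delta> / (2 * t) * norm u \<le> norm (u - (1 / t) *\<^sub>R T u)" if u: "u \<in> C" for u
    proof -
      have "norm (T u - s *\<^sub>R u) \<le> norm (T u - t *\<^sub>R u) + norm ((t - s) *\<^sub>R u)"
        using norm_triangle_ineq[of "T u - t *\<^sub>R u" "(t - s) *\<^sub>R u"] by (simp add: algebra_simps)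
      moreover have "norm ((t - s) *\<^sub>R u) \<le> \<delta> / 2 * norm u"
        using mult_right_mono[of "t - s" "\<delta> / 2" "norm u"] t by simp
      ultimately have "\<delta> / 2 * norm u \<le> norm (T u - t *\<^sub>R u)"
        using gap[OF u] by simp
      moreover have "norm (u - (1 / t) *\<^sub>R T u) = norm ((1 / t) *\<^sub>R (T u - t *\<^sub>R u))"
        using \<open>0 < t\<close> by (simp add: scaleR_diff_right norm_minus_commute)
      then have "norm (u - (1 / t) *\<^sub>R T u) = norm (T u - t *\<^sub>R u) / t"
        using \<open>0 < t\<close> by simp
      ultimately show ?thesis using \<open>0 < t\<close> by (simp add: field_simps)
    qed
    then have "(\<delta> / (2 * t))\<^sup>2 * (real (n + 1) * ((1 / t) ^ n * norm ((T ^^ n) x))) \<le> M * norm x"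
      using \<open>0 < t\<close> \<delta>
      by (intro resolvent_square_coefficient_bound[OF \<open>0 \<le> M\<close> normal _ x _ _ tail]) auto
    moreover have "(\<delta> / (2 * t))\<^sup>2 * (real (n + 1) * ((1 / t) ^ n * norm ((T ^^ n) x)))
        = ?lhs / t ^ (n + 2)"
      by (simp add: power_divide power_mult_distrib power_add power2_eq_square)
    ultimately show ?thesis using \<open>0 < t\<close> by (simp add: pos_divide_le_eq)
  qed
  have "((\<lambda>t. M * norm x * t ^ (n + 2)) \<longlongrightarrow> M * norm x * s ^ (n + 2)) (at_right s)"
    by (intro tendsto_intros)
  moreover have "\<forall>\<^sub>F t in at_right s. ?lhs \<le> M * norm x * t ^ (n + 2)"
    unfolding eventually_at_right_field using * \<delta> by (intro exI[of _ "s + \<delta> / 2"]) auto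
  ultimately show ?thesis
    by (rule tendsto_lowerbound) simp
qed

section \<open>The interval of approximate eigenvalues\<close>

text \<open>
  A gap at \<open>s\<close> would bound \<open>(n + 1) * norm ((T ^^ n) x)\<close> by a fixed multiple of \<open>s ^ (n + 2)\<close> for all
  \<open>x \<in> D\<close>, since \<open>D\<close> is bounded, and hence also \<open>n + 1\<close> times the norm of \<open>T ^^ n\<close>, since \<open>D\<close>
  determines that norm. For \<open>s > 0\<close> the norm is at least \<open>s ^ n\<close>, so the numbers \<open>n + 1\<close> would be
  bounded. For \<open>s = 0\<close> the estimate forces \<open>T = 0\<close> on the wedge, which contradicts the gap.
\<close>
lemma mem_approx_point_spectrum:
  assumes normal: "normal_wedge C" and D: "D \<subseteq> C" "bounded D"
    and norming: "\<And>n b. 1 \<le> n \<Longrightarrow> (\<And>x. x \<in> D \<Longrightarrow> norm ((T ^^ n) x) \<le> b) \<Longrightarrow> cone_norm C (T ^^ n) \<le> b"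
    and s: "0 \<le> s" "s \<le> cone_spectral_radius C T" "\<And>x. x \<in> D \<Longrightarrow> local_spectral_radius T x \<le> s"
  shows "s \<in> approx_point_spectrum C T"
proof (rule ccontr)
  assume "s \<notin> approx_point_spectrum C T"
  then obtain \<delta> where \<delta>: "0 < \<delta>" "\<And>u. u \<in> C \<Longrightarrow> \<delta> * norm u \<le> norm (T u - s *\<^sub>R u)"
    using not_approx_point_spectrumD s(1) by blast
  obtain M0 where M0: "\<And>u v. u \<in> C \<Longrightarrow> v \<in> C \<Longrightarrow> wedge_le C u v \<Longrightarrow> norm u \<le> M0 * norm v"
    using normal unfolding normal_wedge_def by blast
  define M where "M = max M0 0"
  have M: "0 \<le> M" by (simp add: M_def)
  have M_normal: "norm u \<le> M * norm v" if "u \<in> C" "v \<in> C" "wedge_le C u v" for u v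
  proof -
    have "M0 * norm v \<le> M * norm v" unfolding M_def by (intro mult_right_mono) auto
    then show ?thesis using M0[OF that] by simp
  qed
  obtain K where K: "\<And>x. x \<in> D \<Longrightarrow> norm x \<le> K"
    using D(2) unfolding bounded_iff by blast
  define A where "A n = (\<delta> / 2)\<^sup>2 * real (n + 1)" for n
  have A: "0 < A n" for n unfolding A_def using \<delta> by simp
  have bound: "A n * cone_norm C (T ^^ n) \<le> M * K * s ^ (n + 2)" if "1 \<le> n" for n
  proof -
    have "cone_norm C (T ^^ n) \<le> M * K * s ^ (n + 2) / A n"
    proof (rule norming[OF that])
      fix x assume x: "x \<in> D"
      have "A n * norm ((T ^^ n) x) \<le> M * norm x * s ^ (n + 2)"
        using iterate_bound_of_spectral_gap[OF M M_normal _ s(3)[OF x] \<delta>, of n] x D(1)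
        by (auto simp: A_def mult.assoc)
      also have "\<dots> \<le> M * K * s ^ (n + 2)"
        using K[OF x] M s(1) by (intro mult_right_mono mult_left_mono) auto
      finally show "norm ((T ^^ n) x) \<le> M * K * s ^ (n + 2) / A n"
        using A[of n] by (simp add: pos_le_divide_eq mult.commute)
    qed
    then show ?thesis using A[of n] by (simp add: pos_le_divide_eq mult.commute)
  qed
  show False
  proof (cases "s = 0")
    case True
    obtain u where u: "u \<in> C" "norm u = 1" using unit_vector by blast
    have "\<delta> \<le> cone_norm C (T ^^ 1)"
      using \<delta>(2)[OF u(1)] norm_iterate_le_cone_norm[OF u(1), of 1] u(2) True by simp
    then have "0 < A 1 * cone_norm C (T ^^ 1)" using A[of 1] \<delta>(1) by (intro mult_pos_pos) auto
    then show False using bound[of 1] True by simp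
  next
    case False
    then have "0 < s" using s(1) by simp
    have A_le: "A n \<le> M * K * s\<^sup>2" if n: "1 \<le> n" for n
    proof -
      have "s ^ n \<le> cone_spectral_radius C T ^ n" using s by (intro power_mono)
      also have "\<dots> \<le> cone_norm C (T ^^ n)" using n by (rule cone_spectral_radius_power_le)
      finally have "A n * s ^ n \<le> A n * cone_norm C (T ^^ n)"
        using A[of n] by (intro mult_left_mono) auto
      also have "\<dots> \<le> (M * K * s\<^sup>2) * s ^ n"
        using bound[OF n] by (simp add: power_add power2_eq_square mult_ac)
      finally show ?thesis using \<open>0 < s\<close> by simp
    qed
    obtain n where "M * K * s\<^sup>2 / (\<delta> / 2)\<^sup>2 < real n" using reals_Archimedean2 by blast
    then have "M * K * s\<^sup>2 < (\<delta> / 2)\<^sup>2 * real n"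
      using \<delta>(1) by (simp add: pos_divide_less_eq mult.commute)
    also have "\<dots> \<le> A (Suc n)" unfolding A_def by (intro mult_left_mono) auto
    finally show False using A_le[of "Suc n"] by simp
  qed
qed

lemma cone_spectral_radius_mem_approx_point_spectrum:
  assumes "normal_wedge C"
  shows "cone_spectral_radius C T \<in> approx_point_spectrum C T"
proof (rule mem_approx_point_spectrum[where D = "{x \<in> C. norm x = 1}"])
  show "bounded {x \<in> C. norm x = 1}" by (auto simp: bounded_iff)
  fix n b assume b: "\<And>x. x \<in> {x \<in> C. norm x = 1} \<Longrightarrow> norm ((T ^^ n) x) \<le> b"
  show "cone_norm C (T ^^ n) \<le> b"
    unfolding cone_norm_def
  proof (rule cSup_least)
    show "{norm ((T ^^ n) x) / norm x |x. x \<in> C \<and> x \<noteq> 0} \<noteq> {}"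
      using unit_vector by force
    fix z assume "z \<in> {norm ((T ^^ n) x) / norm x |x. x \<in> C \<and> x \<noteq> 0}"
    then obtain x where x: "x \<in> C" "x \<noteq> 0" "z = norm ((T ^^ n) x) / norm x" by blast
    have "z = norm ((T ^^ n) ((1 / norm x) *\<^sub>R x))"
      using x by (subst iterate_scaleR) auto
    also have "\<dots> \<le> b" using x by (intro b) (auto intro: scaleR_in)
    finally show "z \<le> b" .
  qed
qed (use assms in \<open>auto simp: cone_spectral_radius_nonneg local_spectral_radius_le\<close>)

end

theorem theorem4p2:
  fixes C C' :: "'a::real_normed_vector set" and T :: "'a \<Rightarrow> 'a"
  assumes "normal_wedge C" and "C \<noteq> {0}"
    and "T ` C \<subseteq> C"
    and "pos_homogeneous_on C T" and "additive_on C T"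
    and "\<exists>L>0. L-lipschitz_on C T"
    and "C' \<subseteq> C" and "bounded C'"
    and "\<forall>n\<ge>1. cone_norm C (T ^^ n) = Sup {norm ((T ^^ n) x) | x. x \<in> C'}"
  shows "{Sup {local_spectral_radius T x | x. x \<in> C'} .. cone_spectral_radius C T}
           \<subseteq> approx_point_spectrum C T
       \<and> cone_spectral_radius C T \<in> approx_point_spectrum C T
       \<and> (\<forall>t \<in> approx_point_spectrum C T. t \<le> cone_spectral_radius C T)"
proof -
  obtain L where "L-lipschitz_on C T" using assms(6) by blast
  then interpret lipschitz_wedge_map C T L
    using assms by unfold_locales (auto simp: normal_wedge_def)
  have radius: "cone_spectral_radius C T \<in> approx_point_spectrum C T"
    using assms(1) by (rule cone_spectral_radius_mem_approx_point_spectrum)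
  let ?R = "{local_spectral_radius T x | x. x \<in> C'}"
  have "s \<in> approx_point_spectrum C T"
    if s: "Sup ?R \<le> s" "s \<le> cone_spectral_radius C T" for s
  proof (cases "C' = {}")
    case True
    \<comment> \<open>Both suprema are then the value of \<open>Sup\<close> at the empty set of reals, which the norming
      hypothesis identifies with the norm of \<open>T\<close>; hence \<open>s\<close> is the spectral radius.\<close>
    have "cone_spectral_radius C T \<le> cone_norm C (T ^^ 1)"
      using cone_spectral_radius_power_le[of 1] by simp
    also have "\<dots> = Sup ?R" using assms(9) True by auto
    finally have "s = cone_spectral_radius C T" using s by linarith
    then show ?thesis using radius by (simp only:)
  next
    case False
    have "bdd_above ?R"
      using assms(7) local_spectral_radius_le by (intro bdd_aboveI) blast
    then have local_le: "local_spectral_radius T x \<le> s" if "x \<in> C'" for x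
      using that s(1) by (intro order_trans[OF cSup_upper s(1)]) auto
    show ?thesis
    proof (rule mem_approx_point_spectrum[OF assms(1,7,8)])
      obtain x where x: "x \<in> C'" using False by blast
      then have "0 \<le> local_spectral_radius T x"
        using assms(7) by (intro local_spectral_radius_nonneg) blast
      then show "0 \<le> s" using local_le[OF x] by simp
    next
      fix n b assume n: "1 \<le> n" and b: "\<And>x. x \<in> C' \<Longrightarrow> norm ((T ^^ n) x) \<le> b"
      have "Sup {norm ((T ^^ n) x) | x. x \<in> C'} \<le> b"
        using False b by (intro cSup_least) auto
      then show "cone_norm C (T ^^ n) \<le> b" using assms(9) n by simp
    qed (use s local_le in auto)
  qed
  then show ?thesis using radius approx_point_spectrum_le by auto
qed

end
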